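(* Let $Y$ be a Young diagram with row lengths $a_1\ge a_2\ge\cdots\ge a_m\ge 0$ and size $|Y|=\sum_{i=1}^m a_i$. If $Y$ is wide, then $\tau^{(2)}(H(Y))=|Y|$.
   Context: A Young diagram with row lengths $a_1\ge\cdots\ge a_m\ge 0$ represents the partition $|Y|=a_1+\cdots+a_m$; its $i$th row $r_i$ has $a_i$ left-aligned squares. Its conjugate $Y'$ is the diagram whose row lengths are the column lengths $b_j=|\{i: a_i\ge j\}|$ of $Y$. A diagram $X$ dominates a diagram $Z$ of the same size if $\sum_{i=1}^k a_i(X)\ge \sum_{i=1}^k a_i(Z)$ for every $k\ge1$ (padding with zero parts). $Y$ is wide if for every subset of its rows, the Young diagram $Z$ formed by those rows dominates its conjugate $Z'$. The tripartite 3-uniform hypergraph $H(Y)$ has vertex sides $R=\{r_1,\dots,r_m\}$, $C=\{c_1,\dots,c_{a_1}\}$, $S=\{s_1,\dots,s_{a_1}\}$ and edge set $\bigcup_{i=1}^m H_i$, where $H_i=\{\{r_i,c_j,s_k\}: 1\le j,k\le a_i\}$. A 2-cover of a hypergraph $H$ is a set $P$ of 2-element vertex sets, each contained in some edge of $H$, such that every edge of $H$ contains some member of $P$; $\tau^{(2)}(H)$ is the minimum size of a 2-cover. *)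

theory Defs
  imports Main
begin

text \<open>A Young diagram is given by the list a = [a_1,...,a_m] of its row lengths,
  required to be weakly decreasing (zero rows allowed).\<close>

definition young :: "nat list \<Rightarrow> bool" where
  "young a \<longleftrightarrow> sorted_wrt (\<ge>) a"

definition size_Y :: "nat list \<Rightarrow> nat" where
  "size_Y a = sum_list a"

definition conjugate :: "nat list \<Rightarrow> nat list" where
  "conjugate a = map (\<lambda>j. length (filter (\<lambda>x. j \<le> x) a)) [1..<Suc (Max (set (0 # a)))]"

text \<open>Dominance, padding with zero parts (take k of a shorter list is the whole list).\<close>
definition dominates :: "nat list \<Rightarrow> nat list \<Rightarrow> bool" where
  "dominates X Z \<longleftrightarrow> (\<forall>k\<ge>1. sum_list (take k Z) \<le> sum_list (take k X))"

definition wide :: "nat list \<Rightarrow> bool" where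
  "wide a \<longleftrightarrow> (\<forall>I. I \<subseteq> {..<length a} \<longrightarrow> dominates (nths a I) (conjugate (nths a I)))"

datatype vert = R nat | C nat | S nat

text \<open>The hypergraph H(Y); row r_i is R i for 0 \<le> i < m (0-indexed),
  columns c_j = C j, s_k = S k for 1 \<le> j,k.\<close>
definition HY :: "nat list \<Rightarrow> vert set set" where
  "HY a = (\<Union>i<length a. {{R i, C j, S k} | j k. 1 \<le> j \<and> j \<le> a ! i \<and> 1 \<le> k \<and> k \<le> a ! i})"

definition is_2cover :: "'v set set \<Rightarrow> 'v set set \<Rightarrow> bool" where
  "is_2cover H P \<longleftrightarrow>
     (\<forall>p\<in>P. card p = 2 \<and> (\<exists>e\<in>H. p \<subseteq> e)) \<and> (\<forall>e\<in>H. \<exists>p\<in>P. p \<subseteq> e)"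

definition tau2 :: "'v set set \<Rightarrow> nat" where
  "tau2 H = (LEAST n. \<exists>P. is_2cover H P \<and> finite P \<and> card P = n)"

end

theory Submission
  imports Defs
begin

text \<open>A 2-cover leaves uncovered in row \<open>i\<close> a set \<open>A\<^sub>i\<close> of columns and a set \<open>B\<^sub>i\<close> of symbols,
  and must contain all pairs from \<open>A\<^sub>i \<times> B\<^sub>i\<close>; so the lower bound amounts to
  \<open>\<Sum>\<^sub>i (|A\<^sub>i| + |B\<^sub>i| - a\<^sub>i) \<le> |\<Union>\<^sub>i A\<^sub>i \<times> B\<^sub>i|\<close>. Put \<open>u\<^sub>i = min |A\<^sub>i| |B\<^sub>i|\<close>, \<open>v\<^sub>i = max |A\<^sub>i| |B\<^sub>i|\<close> and
  \<open>K = max\<^sub>i u\<^sub>i\<close>. Compressing the union to a Young diagram and comparing it with its Durfee square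
  shows that it has at least \<open>\<Sum>\<^sub>t\<^sub><\<^sub>K \<gamma>\<^sub>t\<close> elements, where \<open>\<gamma>\<^sub>t \<ge> K\<close> and \<open>\<gamma>\<^sub>t \<ge> v\<^sub>i\<close> whenever \<open>t < u\<^sub>i\<close>.
  For each \<open>t < K\<close>, wideness at level \<open>K\<close> is applied to the rows with \<open>t < u\<^sub>i\<close> together with all rows
  shorter than \<open>K\<close>; the sum of these \<open>K\<close> inequalities is \<open>K\<close> times the required one.\<close>

lemma double_count:
  assumes "finite X" "finite Y"
  shows "(\<Sum>x\<in>X. card {y\<in>Y. r x y}) = (\<Sum>y\<in>Y. card {x\<in>X. r x y})"
proof -
  have "(\<Sum>x\<in>X. card {y\<in>Y. r x y}) = (\<Sum>x\<in>X. \<Sum>y\<in>Y. if r x y then 1 else 0)"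
    using assms by (simp add: sum.If_cases Int_def)
  also have "\<dots> = (\<Sum>y\<in>Y. \<Sum>x\<in>X. if r x y then 1 else 0)"
    by (rule sum.swap)
  also have "\<dots> = (\<Sum>y\<in>Y. card {x\<in>X. r x y})"
    using assms by (simp add: sum.If_cases Int_def)
  finally show ?thesis .
qed

subsection \<open>Wideness as a condition on sets of rows\<close>

lemma nths_conv_map_nth:
  "nths xs I = map ((!) xs) (filter (\<lambda>i. i \<in> I) [0..<length xs])"
proof -
  have z: "zip xs [0..<length xs] = map (\<lambda>i. (xs ! i, i)) [0..<length xs]"
    by (rule nth_equalityI) auto
  show ?thesis
    unfolding nths_def z by (simp add: filter_map o_def)
qed

lemma sum_length_filter_le:
  fixes xs :: "nat list"
  assumes "finite J"
  shows "(\<Sum>j\<in>J. length (filter (\<lambda>x. j \<le> x) xs)) = (\<Sum>x\<leftarrow>xs. card {j\<in>J. j \<le> x})"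
proof (induction xs)
  case (Cons x xs)
  have "(\<Sum>j\<in>J. length (filter (\<lambda>x. j \<le> x) (x # xs)))
      = (\<Sum>j\<in>J. (if j \<le> x then 1 else 0) + length (filter (\<lambda>x. j \<le> x) xs))"
    by (intro sum.cong) auto
  also have "\<dots> = card {j\<in>J. j \<le> x} + (\<Sum>j\<in>J. length (filter (\<lambda>x. j \<le> x) xs))"
    using assms by (simp add: sum.distrib sum.If_cases Int_def)
  finally show ?case using Cons by simp
qed simp

text \<open>A row of length \<open>x\<close> has \<open>min x k\<close> cells in the first
  \<open>k\<close> columns.\<close>

lemma sum_list_take_conjugate:
  "sum_list (take k (conjugate xs)) = (\<Sum>x\<leftarrow>xs. min x k)"
proof -
  define m where "m = Max (set (0 # xs))"
  have le: "x \<le> m" if "x \<in> set xs" for x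
    unfolding m_def using that by (intro Max_ge) auto
  \<comment> \<open>The conjugate has only \<open>m\<close> parts; cutting at \<open>min k m\<close>
    loses nothing, since no entry exceeds \<open>m\<close>.\<close>
  have t: "take k [1..<Suc m] = [1..<Suc (min k m)]"
    by (rule nth_equalityI) (auto simp del: upt_Suc)
  have "sum_list (take k (conjugate xs))
      = (\<Sum>j\<leftarrow>[1..<Suc (min k m)]. length (filter (\<lambda>x. j \<le> x) xs))"
    unfolding conjugate_def m_def[symmetric] by (simp only: take_map t)
  also have "\<dots> = (\<Sum>j\<in>{1..<Suc (min k m)}. length (filter (\<lambda>x. j \<le> x) xs))"
    by (simp only: interv_sum_list_conv_sum_set_nat set_upt)
  also have "\<dots> = (\<Sum>x\<leftarrow>xs. card {j\<in>{1..<Suc (min k m)}. j \<le> x})"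
    by (rule sum_length_filter_le) simp
  also have "\<dots> = (\<Sum>x\<leftarrow>xs. min x k)"
  proof (intro arg_cong[where f = sum_list] map_cong refl)
    fix x assume "x \<in> set xs"
    then have "{j\<in>{1..<Suc (min k m)}. j \<le> x} = {1..min x k}"
      using le by fastforce
    then show "card {j\<in>{1..<Suc (min k m)}. j \<le> x} = min x k" by simp
  qed
  finally show ?thesis .
qed

text \<open>Dominance at \<open>k\<close> compares the cells in the first \<open>k\<close> columns
  of the rows \<open>I\<close> with those in the first \<open>k\<close> of these rows, which serve
  as \<open>T\<close>. As a mere set, \<open>T\<close> frees later arguments from the order of the
  list.\<close>

lemma wide_rows:
  assumes "wide a" "I \<subseteq> {..<length a}"
  obtains T where "T \<subseteq> I" "card T \<le> k" "(\<Sum>i\<in>I. min (a ! i) k) \<le> (\<Sum>i\<in>T. a ! i)"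
proof (cases "k = 0")
  case True
  then show ?thesis using that[of "{}"] by simp
next
  case False
  define js where "js = filter (\<lambda>i. i \<in> I) [0..<length a]"
  have js: "distinct js" "set js = I" "nths a I = map ((!) a) js"
    using assms(2) by (auto simp: js_def nths_conv_map_nth)
  have "sum_list (take k (conjugate (nths a I))) \<le> sum_list (take k (nths a I))"
    using assms False by (simp add: wide_def dominates_def)
  then have "(\<Sum>i\<leftarrow>js. min (a ! i) k) \<le> (\<Sum>i\<leftarrow>take k js. a ! i)"
    by (simp add: sum_list_take_conjugate js(3) take_map o_def)
  then have "(\<Sum>i\<in>I. min (a ! i) k) \<le> (\<Sum>i\<in>set (take k js). a ! i)"
    using js(1,2) by (simp add: sum_list_distinct_conv_sum_set)
  moreover have "set (take k js) \<subseteq> I" "card (set (take k js)) \<le> k"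
    using js(2) set_take_subset[of k js] card_length[of "take k js"] by auto
  ultimately show ?thesis using that by blast
qed

subsection \<open>The averaging argument\<close>

text \<open>At level \<open>t\<close>, each of the at most \<open>K\<close> rows of \<open>T\<close>
  costs at most \<open>\<gamma> t\<close> beyond its slack \<open>a i - v i\<close>, or in all if it
  is shorter than \<open>K\<close>. Over all levels a row with \<open>K \<le> a i\<close> yields
  \<open>K\<close> exactly \<open>u i\<close> times, and a shorter row yields \<open>a i\<close>
  exactly \<open>K\<close> times, so a factor \<open>K\<close> cancels.\<close>

lemma weights_bound:
  fixes a u v \<gamma> :: "nat \<Rightarrow> nat"
  assumes fin: "finite I"
    and ua: "\<And>i. i \<in> I \<Longrightarrow> u i \<le> a i" and va: "\<And>i. i \<in> I \<Longrightarrow> v i \<le> a i"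
    and uK: "\<And>i. i \<in> I \<Longrightarrow> u i \<le> K"
    and K\<gamma>: "\<And>t. t < K \<Longrightarrow> K \<le> \<gamma> t"
    and v\<gamma>: "\<And>i t. i \<in> I \<Longrightarrow> t < u i \<Longrightarrow> v i \<le> \<gamma> t"
    and wd: "\<And>J. J \<subseteq> I \<Longrightarrow>
      \<exists>T\<subseteq>J. card T \<le> K \<and> (\<Sum>i\<in>J. min (a i) K) \<le> (\<Sum>i\<in>T. a i)"
  shows "(\<Sum>i\<in>I. u i + v i) \<le> (\<Sum>i\<in>I. a i) + (\<Sum>t<K. \<gamma> t)"
proof (cases "K = 0")
  case True
  then show ?thesis using uK va by (simp add: sum_mono)
next
  case False
  define W where "W = {i\<in>I. a i < K}"
  define L where "L = {i\<in>I. K \<le> a i}"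
  define J where "J t = {i\<in>L. t < u i}" for t
  have finWL: "finite W" "finite L" "finite (J t)" for t
    using fin by (auto simp: W_def L_def J_def)
  have IWL: "I = W \<union> L" "W \<inter> L = {}" by (auto simp: W_def L_def)
  have level: "K * card (J t) + (\<Sum>i\<in>W. a i) \<le> (\<Sum>i\<in>J t. a i - v i) + K * \<gamma> t"
    if t: "t < K" for t
  proof -
    have "W \<union> J t \<subseteq> I" by (auto simp: W_def L_def J_def)
    from wd[OF this] obtain T where T: "T \<subseteq> W \<union> J t" "card T \<le> K"
      "(\<Sum>i\<in>W \<union> J t. min (a i) K) \<le> (\<Sum>i\<in>T. a i)" by blast
    have dj: "W \<inter> J t = {}" by (auto simp: W_def L_def J_def)
    have finT: "finite T" using T(1) finWL by (meson finite_Un finite_subset)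
    have "(\<Sum>i\<in>W \<union> J t. min (a i) K) = (\<Sum>i\<in>W. a i) + (\<Sum>i\<in>J t. K)"
      unfolding sum.union_disjoint[OF finWL(1) finWL(3) dj]
      by (intro arg_cong2[where f = plus] sum.cong) (auto simp: W_def J_def L_def)
    then have "K * card (J t) + (\<Sum>i\<in>W. a i) \<le> (\<Sum>i\<in>T. a i)"
      using T(3) by (simp add: mult.commute)
    also have "\<dots> = (\<Sum>i\<in>T \<inter> J t. a i) + (\<Sum>i\<in>T - J t. a i)"
      by (rule sum.Int_Diff[OF finT])
    also have "(\<Sum>i\<in>T \<inter> J t. a i) = (\<Sum>i\<in>T \<inter> J t. a i - v i) + (\<Sum>i\<in>T \<inter> J t. v i)"
      unfolding sum.distrib[symmetric] using va by (intro sum.cong) (auto simp: J_def L_def)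
    also have "(\<Sum>i\<in>T \<inter> J t. a i - v i) \<le> (\<Sum>i\<in>J t. a i - v i)"
      using finWL by (intro sum_mono2) auto
    also have "(\<Sum>i\<in>T \<inter> J t. v i) \<le> (\<Sum>i\<in>T \<inter> J t. \<gamma> t)"
      using v\<gamma> by (intro sum_mono) (auto simp: J_def L_def)
    also have "(\<Sum>i\<in>T - J t. a i) \<le> (\<Sum>i\<in>T - J t. \<gamma> t)"
      using T(1) K\<gamma>[OF t] by (intro sum_mono) (auto simp: W_def)
    finally have "K * card (J t) + (\<Sum>i\<in>W. a i)
        \<le> (\<Sum>i\<in>J t. a i - v i) + ((\<Sum>i\<in>T \<inter> J t. \<gamma> t) + (\<Sum>i\<in>T - J t. \<gamma> t))"
      by simp
    also have "(\<Sum>i\<in>T \<inter> J t. \<gamma> t) + (\<Sum>i\<in>T - J t. \<gamma> t) = card T * \<gamma> t"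
      by (simp add: sum.Int_Diff[OF finT, symmetric, of "\<lambda>_. \<gamma> t"] del: sum_constant)
         simp
    also have "\<dots> \<le> K * \<gamma> t" using T(2) by simp
    finally show ?thesis by simp
  qed
  have cardJ: "(\<Sum>t<K. card (J t)) = (\<Sum>i\<in>L. u i)"
  proof -
    have "(\<Sum>t<K. card (J t)) = (\<Sum>i\<in>L. card {t\<in>{..<K}. t < u i})"
      unfolding J_def using finWL by (intro double_count) auto
    also have "\<dots> = (\<Sum>i\<in>L. u i)"
    proof (intro sum.cong refl)
      fix i assume "i \<in> L"
      then have "{t\<in>{..<K}. t < u i} = {..<u i}" using uK by (fastforce simp: L_def)
      then show "card {t\<in>{..<K}. t < u i} = u i" by simp
    qed
    finally show ?thesis .
  qed
  have "K * ((\<Sum>i\<in>L. u i) + (\<Sum>i\<in>W. a i)) = (\<Sum>t<K. K * card (J t) + (\<Sum>i\<in>W. a i))"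
    by (simp add: cardJ[symmetric] sum.distrib sum_distrib_left algebra_simps)
  also have "\<dots> \<le> (\<Sum>t<K. (\<Sum>i\<in>J t. a i - v i) + K * \<gamma> t)"
    using level by (intro sum_mono) auto
  \<comment> \<open>Enlarging \<open>J t\<close> to \<open>L\<close> makes the slack the same at
    every level, so it too gets the factor \<open>K\<close>.\<close>
  also have "\<dots> \<le> (\<Sum>t<K. (\<Sum>i\<in>L. a i - v i) + K * \<gamma> t)"
    using finWL by (intro sum_mono add_mono sum_mono2) (auto simp: J_def)
  also have "\<dots> = K * ((\<Sum>i\<in>L. a i - v i) + (\<Sum>t<K. \<gamma> t))"
    by (simp add: sum.distrib sum_distrib_left algebra_simps)
  finally have main: "(\<Sum>i\<in>L. u i) + (\<Sum>i\<in>W. a i) \<le> (\<Sum>i\<in>L. a i - v i) + (\<Sum>t<K. \<gamma> t)"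
    using False by simp
  have "(\<Sum>i\<in>L. a i) = (\<Sum>i\<in>L. a i - v i) + (\<Sum>i\<in>L. v i)"
    unfolding sum.distrib[symmetric] using va by (intro sum.cong) (auto simp: L_def)
  \<comment> \<open>Of the two copies of \<open>a i\<close>, \<open>main\<close> pays for one and
    the sum of all \<open>a i\<close> for the other.\<close>
  moreover have "(\<Sum>i\<in>W. u i + v i) \<le> (\<Sum>i\<in>W. a i + a i)"
    using ua va by (intro sum_mono add_mono) (auto simp: W_def)
  ultimately show ?thesis
    using main unfolding IWL(1) sum.union_disjoint[OF finWL(1,2) IWL(2)]
    by (simp add: sum.distrib)
qed

subsection \<open>Unions of rectangles\<close>

text \<open>Read \<open>N\<close> as the row lengths of a diagram containing a \<open>K\<close> by
  \<open>K\<close> square; the cardinality is then the length of column \<open>t\<close>. At most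
  \<open>K \<le> N t\<close> cells of that column lie in the first \<open>K\<close> rows, so row
  \<open>t\<close> together with the rest of the column bounds the maximum. For distinct
  \<open>t < K\<close> these pieces are disjoint.\<close>

lemma durfee_sum:
  fixes N :: "nat \<Rightarrow> nat"
  assumes "K \<le> n" and KN: "\<And>s. s < K \<Longrightarrow> K \<le> N s"
  shows "(\<Sum>t<K. max (N t) (card {s\<in>{..<n}. t < N s})) \<le> (\<Sum>s<n. N s)"
proof -
  have "max (N t) (card {s\<in>{..<n}. t < N s}) \<le> N t + card {s\<in>{K..<n}. t < N s}"
    if "t < K" for t
  proof -
    have "card {s\<in>{..<n}. t < N s} \<le> card ({..<K} \<union> {s\<in>{K..<n}. t < N s})"
      by (intro card_mono) auto
    also have "\<dots> \<le> K + card {s\<in>{K..<n}. t < N s}"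
      using card_Un_le[of "{..<K}"] by simp
    finally show ?thesis using KN[OF that] by simp
  qed
  then have "(\<Sum>t<K. max (N t) (card {s\<in>{..<n}. t < N s}))
      \<le> (\<Sum>t<K. N t + card {s\<in>{K..<n}. t < N s})"
    by (intro sum_mono) auto
  also have "\<dots> = (\<Sum>t<K. N t) + (\<Sum>s\<in>{K..<n}. card {t\<in>{..<K}. t < N s})"
    by (simp only: sum.distrib double_count[OF finite_lessThan finite_atLeastLessThan])
  also have "(\<Sum>s\<in>{K..<n}. card {t\<in>{..<K}. t < N s}) \<le> (\<Sum>s\<in>{K..<n}. N s)"
  proof (intro sum_mono)
    fix s
    have "card {t\<in>{..<K}. t < N s} \<le> card {..<N s}" by (intro card_mono) auto
    then show "card {t\<in>{..<K}. t < N s} \<le> N s" by simp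
  qed
  also have "(\<Sum>t<K. N t) + (\<Sum>s\<in>{K..<n}. N s) = (\<Sum>s<n. N s)"
    using \<open>K \<le> n\<close> by (simp add: sum.atLeastLessThan_concat lessThan_atLeast0)
  finally show ?thesis by simp
qed

text \<open>Compression preserves size: each \<open>c\<close> contributes one cell to every layer
  \<open>s\<close> below its degree, and \<open>n\<close> bounds all degrees.\<close>

lemma card_eq_sum_degree_counts:
  fixes n :: nat
  assumes X: "finite X" and G: "G \<subseteq> X \<times> Y" and Y: "finite Y" "card Y \<le> n"
  shows "card G = (\<Sum>s<n. card {c\<in>X. s < card (G `` {c})})"
proof -
  have fin: "finite (G `` {c})" and le: "card (G `` {c}) \<le> n" for c
  proof -
    have sub: "G `` {c} \<subseteq> Y" using G by auto
    show "finite (G `` {c})" using sub Y(1) by (rule finite_subset)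
    show "card (G `` {c}) \<le> n" using card_mono[OF Y(1) sub] Y(2) by simp
  qed
  have "G = (SIGMA c:X. G `` {c})" using G by auto
  then have "card G = (\<Sum>c\<in>X. card (G `` {c}))"
    using X fin by (metis card_SigmaI)
  also have "\<dots> = (\<Sum>c\<in>X. card {s\<in>{..<n}. s < card (G `` {c})})"
  proof (intro sum.cong refl)
    fix c
    have "{s\<in>{..<n}. s < card (G `` {c})} = {..<card (G `` {c})}" using le[of c] by auto
    then show "card (G `` {c}) = card {s\<in>{..<n}. s < card (G `` {c})}" by simp
  qed
  also have "\<dots> = (\<Sum>s<n. card {c\<in>X. s < card (G `` {c})})"
    using X by (intro double_count) auto
  finally show ?thesis .
qed

lemma wide_card_union_rectangles:
  assumes w: "wide a"
    and A: "\<And>i. i < length a \<Longrightarrow> A i \<subseteq> {1..a ! i}"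
    and B: "\<And>i. i < length a \<Longrightarrow> B i \<subseteq> {1..a ! i}"
  shows "(\<Sum>i<length a. card (A i) + card (B i))
    \<le> (\<Sum>i<length a. a ! i) + card (\<Union>i<length a. A i \<times> B i)"
proof (cases "a = []")
  case False
  define G where "G = (\<Union>i<length a. A i \<times> B i)"
  define n where "n = Max (set a)"
  define N where "N s = card {c\<in>{1..n}. s < card (G `` {c})}" for s
  define u where "u i = min (card (A i)) (card (B i))" for i
  define v where "v i = max (card (A i)) (card (B i))" for i
  define K where "K = Max (u ` {..<length a})"
  define \<gamma> where "\<gamma> t = max (N t) (card {s\<in>{..<n}. t < N s})" for t
  have an: "a ! i \<le> n" if "i < length a" for i
    unfolding n_def using that by (intro Max_ge) auto
  have finA: "finite (A i)" "finite (B i)" if "i < length a" for i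
    using A[OF that] B[OF that] by (auto intro: finite_subset)
  have cA: "card (A i) \<le> a ! i" "card (B i) \<le> a ! i" if "i < length a" for i
    using card_mono[OF _ A[OF that]] card_mono[OF _ B[OF that]] by auto
  have G: "G \<subseteq> {1..n} \<times> {1..n}"
    unfolding G_def using A B an by fastforce
  have cardG: "card G = (\<Sum>s<n. N s)"
    unfolding N_def using G by (intro card_eq_sum_degree_counts) auto
  \<comment> \<open>Every \<open>c\<close> in \<open>A i\<close> is related to all of
    \<open>B i\<close>, so the compressed diagram with rows \<open>N s\<close> contains a corner
    rectangle of \<open>card (B i)\<close> rows of length \<open>card (A i)\<close>.\<close>
  have N: "card (A i) \<le> N s" if i: "i < length a" and s: "s < card (B i)" for i s
  proof -
    have "A i \<subseteq> {c\<in>{1..n}. s < card (G `` {c})}"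
    proof
      fix c assume c: "c \<in> A i"
      have "B i \<subseteq> G `` {c}" using c i by (auto simp: G_def)
      moreover have "G `` {c} \<subseteq> {1..n}" using G by auto
      ultimately have "card (B i) \<le> card (G `` {c})"
        by (meson card_mono finite_atLeastAtMost finite_subset)
      then show "c \<in> {c\<in>{1..n}. s < card (G `` {c})}"
        using c s A[OF i] an[OF i] by fastforce
    qed
    then show ?thesis unfolding N_def by (intro card_mono) auto
  qed
  \<comment> \<open>The rectangle of a row \<open>l\<close> attaining the maximum provides the
    \<open>K\<close> by \<open>K\<close> square.\<close>
  have "K \<in> u ` {..<length a}"
    unfolding K_def using False by (intro Max_in) auto
  then obtain l where l: "l < length a" "K = u l" by auto
  have uK: "u i \<le> K" if "i < length a" for i
    unfolding K_def using that by (intro Max_ge) auto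
  have KN: "K \<le> N s" if "s < K" for s
    using N[OF l(1), of s] that l(2) by (auto simp: u_def)
  have Kn: "K \<le> n" using cA[OF l(1)] an[OF l(1)] l(2) by (auto simp: u_def)
  have v\<gamma>: "v i \<le> \<gamma> t" if i: "i < length a" and t: "t < u i" for i t
  proof -
    \<comment> \<open>Column \<open>t\<close> has at least \<open>card (B i)\<close> cells, because
      \<open>t < card (A i) \<le> N s\<close> for \<open>s < card (B i)\<close>; row
      \<open>t\<close> has at least \<open>card (A i)\<close>. Hence \<open>\<gamma> t\<close> is
      the maximum of both lengths.\<close>
    have "{..<card (B i)} \<subseteq> {s\<in>{..<n}. t < N s}"
      using N[OF i] cA[OF i] an[OF i] t by (fastforce simp: u_def)
    then have "card (B i) \<le> card {s\<in>{..<n}. t < N s}"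
      using card_mono[of "{s\<in>{..<n}. t < N s}" "{..<card (B i)}"] by simp
    then show ?thesis using N[OF i, of t] t by (auto simp: u_def v_def \<gamma>_def)
  qed
  have "(\<Sum>i<length a. u i + v i) \<le> (\<Sum>i<length a. a ! i) + (\<Sum>t<K. \<gamma> t)"
  proof (rule weights_bound)
    show "u i \<le> a ! i" "v i \<le> a ! i" "u i \<le> K" if "i \<in> {..<length a}" for i
      using that cA uK by (auto simp: u_def v_def min.coboundedI1)
    show "K \<le> \<gamma> t" if "t < K" for t
      using KN[OF that] by (simp add: \<gamma>_def)
    show "v i \<le> \<gamma> t" if "i \<in> {..<length a}" "t < u i" for i t
      using that v\<gamma> by simp
    show "\<exists>T\<subseteq>J. card T \<le> K \<and> (\<Sum>i\<in>J. min (a ! i) K) \<le> (\<Sum>i\<in>T. a ! i)"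
      if "J \<subseteq> {..<length a}" for J
      using wide_rows[OF w that, of K] by metis
  qed simp
  also have "(\<Sum>t<K. \<gamma> t) \<le> card G"
    unfolding \<gamma>_def cardG using Kn KN by (rule durfee_sum)
  also have "(\<Sum>i<length a. u i + v i) = (\<Sum>i<length a. card (A i) + card (B i))"
    by (intro sum.cong) (auto simp: u_def v_def)
  finally show ?thesis by (simp add: G_def)
qed simp

subsection \<open>Covers\<close>

text \<open>This gives the upper bound: there is one row-column pair per cell of the diagram, and
  each edge contains its own.\<close>

lemma is_2cover_row_columns:
  "is_2cover (HY a) ((\<lambda>(i, j). {R i, C j}) ` (SIGMA i:{..<length a}. {1..a ! i}))"
  unfolding is_2cover_def
proof (intro conjI ballI)
  fix p assume "p \<in> (\<lambda>(i, j). {R i, C j}) ` (SIGMA i:{..<length a}. {1..a ! i})"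
  then obtain i j where p: "i < length a" "1 \<le> j" "j \<le> a ! i" "p = {R i, C j}" by auto
  then have "{R i, C j, S j} \<in> HY a" unfolding HY_def by blast
  then show "\<exists>e\<in>HY a. p \<subseteq> e" using p(4) by blast
  show "card p = 2" using p(4) by simp
next
  fix e assume "e \<in> HY a"
  then obtain i j k where "i < length a" "1 \<le> j" "j \<le> a ! i" "e = {R i, C j, S k}"
    unfolding HY_def by blast
  then show "\<exists>p\<in>(\<lambda>(i, j). {R i, C j}) ` (SIGMA i:{..<length a}. {1..a ! i}). p \<subseteq> e"
    by (intro bexI[of _ "{R i, C j}"]) auto
qed

lemma card_image_row_columns:
  "card ((\<lambda>(i, j). {R i, C j}) ` (SIGMA i:{..<length a}. {1..a ! i})) = size_Y a"
proof -
  have "inj_on (\<lambda>(i, j). {R i, C j}) (SIGMA i:{..<length a}. {1..a ! i})"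
    by (auto simp: inj_on_def doubleton_eq_iff)
  then show ?thesis
    by (simp add: card_image size_Y_def sum_list_sum_nth lessThan_atLeast0)
qed

text \<open>The three kinds of pairs are counted separately: row \<open>i\<close> forces
  \<open>a ! i - card (A i)\<close> row-column and \<open>a ! i - card (B i)\<close> row-symbol
  pairs, and \<open>card G\<close> column-symbol pairs are forced overall. The rectangle inequality
  bounds the total.\<close>

lemma wide_size_le_card_2cover:
  assumes w: "wide a" and P: "is_2cover (HY a) P" "finite P"
  shows "size_Y a \<le> card P"
proof -
  define A where "A i = {j\<in>{1..a ! i}. {R i, C j} \<notin> P}" for i
  define B where "B i = {k\<in>{1..a ! i}. {R i, S k} \<notin> P}" for i
  define G where "G = (\<Union>i<length a. A i \<times> B i)"
  define P1 where "P1 = (\<lambda>(i, j). {R i, C j}) ` (SIGMA i:{..<length a}. {1..a ! i} - A i)"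
  define P2 where "P2 = (\<lambda>(i, k). {R i, S k}) ` (SIGMA i:{..<length a}. {1..a ! i} - B i)"
  define P3 where "P3 = (\<lambda>(j, k). {C j, S k}) ` G"
  have AB: "A i \<subseteq> {1..a ! i}" "B i \<subseteq> {1..a ! i}" for i by (auto simp: A_def B_def)
  have finAB: "finite (A i)" "finite (B i)" for i by (auto simp: A_def B_def)
  \<comment> \<open>Two of the three pairs in the edge are excluded by \<open>j \<in> A i\<close>
    and \<open>k \<in> B i\<close>, so the third must cover it.\<close>
  have "{C j, S k} \<in> P" if "i < length a" "j \<in> A i" "k \<in> B i" for i j k
  proof -
    have "{R i, C j, S k} \<in> HY a"
      using that unfolding HY_def A_def B_def by auto
    then obtain p where p: "p \<in> P" "p \<subseteq> {R i, C j, S k}" "card p = 2"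
      using P(1) unfolding is_2cover_def by blast
    from p(3) obtain x y where "p = {x, y}" "x \<noteq> y" by (auto simp: card_2_iff)
    with p(2) have "p = {R i, C j} \<or> p = {R i, S k} \<or> p = {C j, S k}" by auto
    then show ?thesis using p(1) that by (auto simp: A_def B_def)
  qed
  then have sub: "P1 \<union> P2 \<union> P3 \<subseteq> P"
    by (auto simp: P1_def P2_def P3_def G_def A_def B_def)
  have fin: "finite P1" "finite P2" "finite P3"
    using sub P(2) by (auto intro: finite_subset)
  have "P1 \<inter> P2 = {}" "(P1 \<union> P2) \<inter> P3 = {}"
    by (auto simp: P1_def P2_def P3_def doubleton_eq_iff)
  then have "card P1 + card P2 + card P3 = card (P1 \<union> P2 \<union> P3)"
    using fin by (simp add: card_Un_disjoint)
  also have "\<dots> \<le> card P" using sub P(2) by (rule card_mono[rotated])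
  finally have P123: "card P1 + card P2 + card P3 \<le> card P" .
  have compl: "card ({1..a ! i} - A i) + card (A i) = a ! i"
    "card ({1..a ! i} - B i) + card (B i) = a ! i" for i
    using card_mono[OF _ AB(1)[of i]] card_mono[OF _ AB(2)[of i]]
      card_Diff_subset[OF finAB(1) AB(1)[of i]] card_Diff_subset[OF finAB(2) AB(2)[of i]]
    by auto
  have "inj_on (\<lambda>(i, j). {R i, C j}) (SIGMA i:{..<length a}. {1..a ! i} - A i)"
    and "inj_on (\<lambda>(i, k). {R i, S k}) (SIGMA i:{..<length a}. {1..a ! i} - B i)"
    and "inj_on (\<lambda>(j, k). {C j, S k}) G"
    by (auto simp: inj_on_def doubleton_eq_iff)
  then have "card P1 = (\<Sum>i<length a. card ({1..a ! i} - A i))"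
    and "card P2 = (\<Sum>i<length a. card ({1..a ! i} - B i))" and c3: "card P3 = card G"
    by (simp_all add: P1_def P2_def P3_def card_image)
  then have "card P1 + (\<Sum>i<length a. card (A i)) = (\<Sum>i<length a. a ! i)"
    and "card P2 + (\<Sum>i<length a. card (B i)) = (\<Sum>i<length a. a ! i)"
    using compl by (simp_all only: sum.distrib[symmetric])
  moreover have "(\<Sum>i<length a. card (A i) + card (B i)) \<le> (\<Sum>i<length a. a ! i) + card G"
    unfolding G_def using AB by (intro wide_card_union_rectangles[OF w])
  ultimately have "(\<Sum>i<length a. a ! i) \<le> card P"
    using P123 c3 by (simp add: sum.distrib)
  then show ?thesis by (simp add: size_Y_def sum_list_sum_nth lessThan_atLeast0)
qed

theorem theorem2:
  fixes a :: "nat list"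
  assumes "young a" and "wide a"
  shows "tau2 (HY a) = size_Y a"
  unfolding tau2_def
proof (rule Least_equality)
  show "\<exists>P. is_2cover (HY a) P \<and> finite P \<and> card P = size_Y a"
    using is_2cover_row_columns card_image_row_columns by blast
  show "size_Y a \<le> n" if "\<exists>P. is_2cover (HY a) P \<and> finite P \<and> card P = n" for n
    using that wide_size_le_card_2cover[OF assms(2)] by blast
qed

end
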